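(* Let $a,b$ be positive integers with exactly one of $a,b$ odd, and let $G$ be the $a\times b$ grid graph, i.e. the graph with vertex set $\{0,\dots,b-1\}\times\{0,\dots,a-1\}$ (drawn at these integer points of the plane) in which two vertices are adjacent when they are at Euclidean distance $1$. Then in the Game of Cycles on $G$, Player 1 has a winning strategy.
   Context: Game of Cycles: the gameboard is a simple connected graph drawn in the plane without crossings. Players 1 and 2 alternate turns, Player 1 first; on a turn a player must, if possible, direct one currently undirected edge, and it is illegal to create a sink (a vertex all of whose incident edges point into it) or a source (a vertex all of whose incident edges point out of it). A cycle cell is a cycle of the graph bounding a bounded face of the drawing (for the grid, the boundary of a unit square); a player who directs an edge so that all edges of some cycle cell are directed consistently around it wins immediately. Otherwise the player who makes the last legal move wins.
   Formalization: The 1×2 and 2×1 grids are excluded: there the only edge cannot be directed without creating a sink and a source, so no legal move exists and Player 1 cannot win; all other a, b with exactly one odd are covered. *)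

theory Defs
  imports "HOL-Analysis.Product_Vector"
begin

text \<open>A game board is a simple graph together with its cycle cells. An edge is a two-element set of
  vertices. A cell is listed as its vertices in cyclic order, once per cell; the starting point
  and the sense of traversal are immaterial.\<close>

record 'v board =
  verts :: "'v set"
  edges :: "'v set set"
  cells :: "'v list set"

text \<open>An arc \<open>(u, v)\<close> is the edge \<open>{u, v}\<close> directed from \<open>u\<close> to \<open>v\<close>. A position is the set of
  all arcs chosen so far.\<close>

type_synonym 'v arc = "'v \<times> 'v"

definition sink :: "'v board \<Rightarrow> 'v arc set \<Rightarrow> 'v \<Rightarrow> bool" where
  "sink B D v \<longleftrightarrow> v \<in> verts B \<and> (\<forall>u. {u, v} \<in> edges B \<longrightarrow> (u, v) \<in> D)"

definition source :: "'v board \<Rightarrow> 'v arc set \<Rightarrow> 'v \<Rightarrow> bool" where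
  "source B D v \<longleftrightarrow> v \<in> verts B \<and> (\<forall>u. {v, u} \<in> edges B \<longrightarrow> (v, u) \<in> D)"

definition legal_move :: "'v board \<Rightarrow> 'v arc set \<Rightarrow> 'v arc \<Rightarrow> bool" where
  "legal_move B D m \<longleftrightarrow>
     {fst m, snd m} \<in> edges B \<and>
     (fst m, snd m) \<notin> D \<and> (snd m, fst m) \<notin> D \<and>
     (\<forall>v. sink B (insert m D) v \<longrightarrow> sink B D v) \<and>
     (\<forall>v. source B (insert m D) v \<longrightarrow> source B D v)"

text \<open>The arcs obtained by running once around a cyclic vertex list, and the condition that all
  edges of a cell are directed consistently around it, in one sense or the other.\<close>

definition cycle_arcs :: "'v list \<Rightarrow> 'v arc set" where
  "cycle_arcs c = {(c ! i, c ! (Suc i mod length c)) | i. i < length c}"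

definition directed_cell :: "'v arc set \<Rightarrow> 'v list \<Rightarrow> bool" where
  "directed_cell D c \<longleftrightarrow> cycle_arcs c \<subseteq> D \<or> (cycle_arcs c)\<inverse> \<subseteq> D"

definition cell_completed :: "'v board \<Rightarrow> 'v arc set \<Rightarrow> bool" where
  "cell_completed B D \<longleftrightarrow> (\<exists>c \<in> cells B. directed_cell D c)"

text \<open>A play is the list of moves made so far, earliest first; its position is the set of its
  elements.\<close>

definition finished :: "'v board \<Rightarrow> 'v arc list \<Rightarrow> bool" where
  "finished B ms \<longleftrightarrow> cell_completed B (set ms) \<or> (\<forall>m. \<not> legal_move B (set ms) m)"

inductive play :: "'v board \<Rightarrow> 'v arc list \<Rightarrow> bool" for B where
  start: "play B []"
| step: "play B ms \<Longrightarrow> \<not> finished B ms \<Longrightarrow> legal_move B (set ms) m \<Longrightarrow> play B (ms @ [m])"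

datatype player = Player1 | Player2

definition mover :: "nat \<Rightarrow> player" where
  "mover i = (if even i then Player1 else Player2)"

text \<open>Completing a cell ends the game at once, so under both winning conditions the winner is the
  player who made the last move. If no move can be made at all, then nobody wins.\<close>

definition wins :: "'v board \<Rightarrow> player \<Rightarrow> 'v arc list \<Rightarrow> bool" where
  "wins B p ms \<longleftrightarrow> finished B ms \<and> ms \<noteq> [] \<and> mover (length ms - 1) = p"

text \<open>A strategy proposes a move after every play.\<close>

type_synonym 'v strategy = "'v arc list \<Rightarrow> 'v arc"

definition follows :: "player \<Rightarrow> 'v strategy \<Rightarrow> 'v arc list \<Rightarrow> bool" where
  "follows p s ms \<longleftrightarrow> (\<forall>i < length ms. mover i = p \<longrightarrow> ms ! i = s (take i ms))"

text \<open>The strategy must never propose an illegal move when it is its player's turn, and every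
  finished play following it must be won. On a board with finitely many edges every play can be
  continued to a finished one, so nothing has to be said about infinite plays.\<close>

definition winning_strategy :: "'v board \<Rightarrow> player \<Rightarrow> 'v strategy \<Rightarrow> bool" where
  "winning_strategy B p s \<longleftrightarrow>
     (\<forall>ms. play B ms \<and> follows p s ms \<longrightarrow>
        (if finished B ms then wins B p ms
         else mover (length ms) = p \<longrightarrow> legal_move B (set ms) (s ms)))"

definition has_winning_strategy :: "'v board \<Rightarrow> player \<Rightarrow> bool" where
  "has_winning_strategy B p \<longleftrightarrow> (\<exists>s. winning_strategy B p s)"

text \<open>The \<open>a \<times> b\<close> grid has \<open>a\<close> rows and \<open>b\<close> columns. The metric on \<^typ>\<open>real \<times> real\<close> is the
  Euclidean one. The cells are the boundaries of the unit squares.\<close>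

definition plane_point :: "int \<times> int \<Rightarrow> real \<times> real" where
  "plane_point p = (real_of_int (fst p), real_of_int (snd p))"

definition grid_verts :: "nat \<Rightarrow> nat \<Rightarrow> (int \<times> int) set" where
  "grid_verts a b = {0..<int b} \<times> {0..<int a}"

definition grid :: "nat \<Rightarrow> nat \<Rightarrow> (int \<times> int) board" where
  "grid a b =
     \<lparr> verts = grid_verts a b,
       edges = {{p, q} | p q. p \<in> grid_verts a b \<and> q \<in> grid_verts a b \<and>
                              dist (plane_point p) (plane_point q) = 1},
       cells = {[(x, y), (x + 1, y), (x + 1, y + 1), (x, y + 1)] | x y.
                  {(x, y), (x + 1, y), (x + 1, y + 1), (x, y + 1)} \<subseteq> grid_verts a b} \<rparr>"

end

theory Submission
  imports Defs
begin

text \<open>Player 1 plays the mirror-reverse strategy for the half-turn \<open>\<sigma>\<close> of the grid. Since exactly one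
  side is odd, \<open>\<sigma>\<close> fixes no vertex and no cell and exactly one edge, which Player 1 directs first.
  Afterwards Player 1 completes a cell if possible and otherwise answers \<open>(p, q)\<close> by
  \<open>(\<sigma> q, \<sigma> p)\<close>. Positions after Player 1's turn are then invariant under \<open>\<sigma>\<close> combined with reversal,
  which exchanges sinks and sources, so the answer is legal. If it enabled Player 2 to complete a
  cell \<open>c\<close>, then, as the move and its answer do not both lie on \<open>c\<close>, either \<open>c\<close> or \<open>\<sigma> c\<close> could have
  been completed by Player 1 instead of answering.\<close>

section \<open>Monotonicity in the set of arcs\<close>

lemma sink_mono: "D \<subseteq> E \<Longrightarrow> sink B D v \<Longrightarrow> sink B E v"
  unfolding sink_def by blast

lemma source_mono: "D \<subseteq> E \<Longrightarrow> source B D v \<Longrightarrow> source B E v"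
  unfolding source_def by blast

text \<open>A new arc can create a sink only at its head. If it did so over \<open>D\<close>, the
  head would also be a sink over \<open>insert m E\<close>, hence over \<open>E\<close> by legality,
  although the edge of \<open>m\<close> is undirected there. Dually for the source at the
  tail.\<close>

lemma legal_move_antimono:
  assumes "D \<subseteq> E" "legal_move B E m"
  shows "legal_move B D m"
proof -
  obtain p q where m: "m = (p, q)" by fastforce
  have e: "{p, q} \<in> edges B" and n: "(p, q) \<notin> E" "(q, p) \<notin> E"
    and sk: "\<And>v. sink B (insert m E) v \<Longrightarrow> sink B E v"
    and sr: "\<And>v. source B (insert m E) v \<Longrightarrow> source B E v"
    using assms(2) unfolding legal_move_def m by auto
  have "sink B D v" if s: "sink B (insert m D) v" for v
  proof -
    have "sink B E v"
      using sk sink_mono[OF insert_mono[OF assms(1)] s] by blast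
    then have "v \<noteq> q" using e n(1) unfolding sink_def by blast
    then show ?thesis using s unfolding sink_def m by blast
  qed
  moreover have "source B D v" if s: "source B (insert m D) v" for v
  proof -
    have "source B E v"
      using sr source_mono[OF insert_mono[OF assms(1)] s] by blast
    then have "v \<noteq> p" using e n(1) unfolding source_def by blast
    then show ?thesis using s unfolding source_def m by blast
  qed
  ultimately show ?thesis
    using e n assms(1) unfolding legal_move_def m by auto
qed

lemma follows_append:
  assumes "follows p s (ms @ [m])"
  shows "follows p s ms" and "mover (length ms) = p \<Longrightarrow> m = s ms"
proof -
  show "follows p s ms"
    unfolding follows_def
  proof (intro allI impI)
    fix i assume "i < length ms" "mover i = p"
    then show "ms ! i = s (take i ms)"
      using assms[unfolded follows_def, rule_format, of i] by (simp add: nth_append)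
  qed
  show "m = s ms" if "mover (length ms) = p"
    using assms[unfolded follows_def, rule_format, of "length ms"] that by simp
qed

section \<open>Boards with an arc-reversing symmetry\<close>

text \<open>The axis \<open>{z, \<sigma> z}\<close> is the one edge joining a vertex to its image.
  \<open>axis_not_pendant\<close> makes the opening move legal, \<open>cells_card\<close> keeps
  Player 2 from winning with the second arc, and \<open>cells_nowhere_involutive\<close> keeps a
  move and its answer off a common cell.\<close>

locale mirror_board =
  fixes B :: "'v board" and \<sigma> :: "'v \<Rightarrow> 'v" and z :: 'v
  assumes involution [simp]: "\<sigma> (\<sigma> v) = v"
    and verts_mirror: "v \<in> verts B \<Longrightarrow> \<sigma> v \<in> verts B"
    and edges_mirror: "{u, v} \<in> edges B \<Longrightarrow> {\<sigma> u, \<sigma> v} \<in> edges B"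
    and edges_verts: "{u, v} \<in> edges B \<Longrightarrow> u \<in> verts B"
    and no_fixed_vertex: "v \<in> verts B \<Longrightarrow> \<sigma> v \<noteq> v"
    and axis: "{z, \<sigma> z} \<in> edges B"
    and axis_unique: "{v, \<sigma> v} \<in> edges B \<Longrightarrow> {v, \<sigma> v} = {z, \<sigma> z}"
    and axis_not_pendant: "\<exists>u. {z, u} \<in> edges B \<and> u \<noteq> \<sigma> z"
    and cells_mirror: "c \<in> cells B \<Longrightarrow> \<exists>c' \<in> cells B. cycle_arcs c' = map_prod \<sigma> \<sigma> ` cycle_arcs c"
    and cells_nowhere_involutive:
      "c \<in> cells B \<Longrightarrow> (p, q) \<in> cycle_arcs c \<Longrightarrow> (\<sigma> q, \<sigma> p) \<in> cycle_arcs c \<Longrightarrow> {p, q} = {z, \<sigma> z}"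
    and cells_card: "c \<in> cells B \<Longrightarrow> card (cycle_arcs c) > 2"
begin

text \<open>Thanks to the reversal \<open>(z, \<sigma> z)\<close> is its own reply, so one arc on
  the axis already gives a symmetric position; \<open>\<sigma>\<close> alone would turn it into
  \<open>(\<sigma> z, z)\<close>.\<close>

definition reply :: "'v arc \<Rightarrow> 'v arc" where
  "reply m = (\<sigma> (snd m), \<sigma> (fst m))"

lemma reply_Pair [simp]: "reply (p, q) = (\<sigma> q, \<sigma> p)"
  by (simp add: reply_def)

lemma reply_reply [simp]: "reply (reply m) = m"
  by (simp add: reply_def)

definition mirror_closed :: "'v arc set \<Rightarrow> bool" where
  "mirror_closed D \<longleftrightarrow> (\<forall>m \<in> D. reply m \<in> D)"

lemma mirror_closedD: "mirror_closed D \<Longrightarrow> (p, q) \<in> D \<Longrightarrow> (\<sigma> q, \<sigma> p) \<in> D"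
  unfolding mirror_closed_def by force

lemma mirror_closed_insert2:
  "mirror_closed D \<Longrightarrow> mirror_closed (insert (reply m) (insert m D))"
  unfolding mirror_closed_def by auto

lemma source_reply_image: "source B (reply ` D) (\<sigma> v)" if "sink B D v"
  unfolding source_def
proof (intro conjI allI impI)
  show "\<sigma> v \<in> verts B" using that verts_mirror unfolding sink_def by blast
  fix u assume "{\<sigma> v, u} \<in> edges B"
  then have "{\<sigma> u, v} \<in> edges B"
    using edges_mirror[of "\<sigma> v" u] by (simp add: insert_commute)
  then have "(\<sigma> u, v) \<in> D" using that unfolding sink_def by blast
  from imageI[OF this, of reply] show "(\<sigma> v, u) \<in> reply ` D" by simp
qed

lemma sink_reply_image: "sink B (reply ` D) (\<sigma> v)" if "source B D v"
  unfolding sink_def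
proof (intro conjI allI impI)
  show "\<sigma> v \<in> verts B" using that verts_mirror unfolding source_def by blast
  fix u assume "{u, \<sigma> v} \<in> edges B"
  then have "{v, \<sigma> u} \<in> edges B"
    using edges_mirror[of u "\<sigma> v"] by (simp add: insert_commute)
  then have "(v, \<sigma> u) \<in> D" using that unfolding source_def by blast
  from imageI[OF this, of reply] show "(u, \<sigma> v) \<in> reply ` D" by simp
qed

lemma reply_image_eq:
  assumes "mirror_closed D"
  shows "reply ` D = D"
proof
  show "reply ` D \<subseteq> D" using assms unfolding mirror_closed_def by blast
  then show "D \<subseteq> reply ` D" by (metis image_eqI reply_reply assms mirror_closed_def subsetI)
qed

text \<open>Here \<open>reply m\<close> is played instead of \<open>m\<close>, not after it. It
  serves to turn a threat \<open>n\<close> of Player 2 into the threat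
  \<open>reply n\<close>.\<close>

lemma legal_move_reply:
  assumes D: "mirror_closed D" and m: "legal_move B D m"
  shows "legal_move B D (reply m)"
proof -
  obtain p q where pq: "m = (p, q)" by fastforce
  have e: "{p, q} \<in> edges B" and n: "(p, q) \<notin> D" "(q, p) \<notin> D"
    and sk: "\<And>v. sink B (insert m D) v \<Longrightarrow> sink B D v"
    and sr: "\<And>v. source B (insert m D) v \<Longrightarrow> source B D v"
    using m unfolding legal_move_def pq by auto
  have im: "reply ` insert (reply m) D = insert m D"
    using reply_image_eq[OF D] by simp
  have "sink B D v" if "sink B (insert (reply m) D) v" for v
    using sink_reply_image[OF sr[OF source_reply_image[OF that, unfolded im]]]
    by (simp add: reply_image_eq[OF D])
  moreover have "source B D v" if "source B (insert (reply m) D) v" for v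
    using source_reply_image[OF sk[OF sink_reply_image[OF that, unfolded im]]]
    by (simp add: reply_image_eq[OF D])
  moreover have "{\<sigma> q, \<sigma> p} \<in> edges B"
    using e edges_mirror by (simp add: insert_commute)
  moreover have "(\<sigma> q, \<sigma> p) \<notin> D" "(\<sigma> p, \<sigma> q) \<notin> D"
    using n mirror_closedD[OF D] by force+
  ultimately show ?thesis
    unfolding legal_move_def pq by simp
qed

text \<open>The invariant of positions handed to Player 2 when the game has not been won by a cell.
  The last clause forbids Player 2 an immediate win by a cell.\<close>

definition good :: "'v arc set \<Rightarrow> bool" where
  "good D \<longleftrightarrow> mirror_closed D \<and> (z, \<sigma> z) \<in> D \<and>
     (\<forall>n. legal_move B D n \<longrightarrow> \<not> cell_completed B (insert n D))"

text \<open>Since the axis is already directed, a move and its reply have different heads and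
  different tails.\<close>

lemma legal_move_not_axis:
  assumes "(z, \<sigma> z) \<in> D" "legal_move B D (p, q)"
  shows "{p, q} \<noteq> {z, \<sigma> z}" "q \<noteq> \<sigma> p"
proof -
  have e: "{p, q} \<in> edges B" "(p, q) \<notin> D" "(q, p) \<notin> D"
    using assms(2) unfolding legal_move_def by auto
  show *: "{p, q} \<noteq> {z, \<sigma> z}"
    using e assms(1) by (auto simp: doubleton_eq_iff)
  show "q \<noteq> \<sigma> p"
    using * e(1) axis_unique by blast
qed

text \<open>If the reply made its head \<open>\<sigma> p\<close> a sink, then by symmetry
  \<open>p\<close> would be a source afterwards. The reply does not start at \<open>p\<close>, so
  \<open>m\<close> itself would have made \<open>p\<close> a source. Dually for the tail
  \<open>\<sigma> q\<close>.\<close>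

lemma legal_reply:
  assumes D: "good D" and m: "legal_move B D m"
  shows "legal_move B (insert m D) (reply m)"
proof -
  obtain p q where pq: "m = (p, q)" by fastforce
  let ?D' = "insert (reply m) (insert m D)"
  have closed: "mirror_closed D" and zD: "(z, \<sigma> z) \<in> D"
    using D unfolding good_def by auto
  have e: "{p, q} \<in> edges B" and n: "(p, q) \<notin> D" "(q, p) \<notin> D"
    and sk: "\<And>v. sink B (insert m D) v \<Longrightarrow> sink B D v"
    and sr: "\<And>v. source B (insert m D) v \<Longrightarrow> source B D v"
    using m unfolding legal_move_def pq by auto
  have qp: "q \<noteq> \<sigma> p" using legal_move_not_axis(2)[OF zD] m pq by blast
  then have pq': "p \<noteq> \<sigma> q" by auto
  \<comment> \<open>This keeps the reply from being \<open>m\<close> reversed; \<open>pq'\<close>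
    keeps it from being \<open>m\<close> itself.\<close>
  have fix_p: "\<sigma> p \<noteq> p" using e edges_verts no_fixed_vertex by blast
  have not_sink: "\<not> sink B D q" using e n unfolding sink_def by blast
  have not_source: "\<not> source B D p" using e n unfolding source_def by blast
  have im: "reply ` ?D' = ?D'"
    by (rule reply_image_eq[OF mirror_closed_insert2[OF closed]])
  have "sink B (insert m D) v" if s: "sink B ?D' v" for v
  proof (cases "v = \<sigma> p")
    case True
    have "source B ?D' p" using source_reply_image[OF s] im True by simp
    then have "source B (insert m D) p"
      using pq' unfolding source_def pq by auto
    then show ?thesis using sr not_source by blast
  next
    case False
    then show ?thesis using s unfolding sink_def pq by auto
  qed
  moreover have "source B (insert m D) v" if s: "source B ?D' v" for v
  proof (cases "v = \<sigma> q")
    case True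
    have "sink B ?D' q" using sink_reply_image[OF s] im True by simp
    then have "sink B (insert m D) q"
      using qp unfolding sink_def pq by auto
    then show ?thesis using sk not_sink by blast
  next
    case False
    then show ?thesis using s unfolding source_def pq by auto
  qed
  moreover have "{\<sigma> q, \<sigma> p} \<in> edges B"
    using e edges_mirror by (simp add: insert_commute)
  moreover have "(\<sigma> q, \<sigma> p) \<notin> insert m D" "(\<sigma> p, \<sigma> q) \<notin> insert m D"
    using n mirror_closedD[OF closed, of "\<sigma> q" "\<sigma> p"] mirror_closedD[OF closed, of "\<sigma> p" "\<sigma> q"]
      pq' fix_p by (auto simp: pq)
  ultimately show ?thesis
    unfolding legal_move_def pq by simp
qed

text \<open>\<open>\<sigma>\<close> carries a boundary to a boundary, and the reversal only
  exchanges its two senses, both of which count.\<close>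

lemma directed_cell_reply_image:
  assumes "c \<in> cells B" "A = cycle_arcs c \<or> A = (cycle_arcs c)\<inverse>"
  obtains c' where "c' \<in> cells B" "reply ` A = cycle_arcs c' \<or> reply ` A = (cycle_arcs c')\<inverse>"
proof -
  obtain c' where c': "c' \<in> cells B" "cycle_arcs c' = map_prod \<sigma> \<sigma> ` cycle_arcs c"
    using cells_mirror[OF assms(1)] by blast
  have "reply ` (X\<inverse>) = map_prod \<sigma> \<sigma> ` X" and "reply ` X = (map_prod \<sigma> \<sigma> ` X)\<inverse>" for X
    by (force simp: image_iff)+
  then show thesis using that[OF c'(1)] c'(2) assms(2) by metis
qed

text \<open>Let \<open>n\<close> complete a cell with directed boundary \<open>A\<close>. If
  \<open>reply m\<close> is not in \<open>A\<close>, then \<open>n\<close> already won for Player 1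
  before the reply. Otherwise \<open>m\<close> is not in \<open>A\<close>, so \<open>reply m\<close>
  is not in the mirrored boundary, and \<open>reply n\<close> already won.\<close>

lemma good_reply:
  assumes D: "good D" and m: "legal_move B D m"
    and no_win: "\<And>n. legal_move B (insert m D) n \<Longrightarrow> \<not> cell_completed B (insert n (insert m D))"
  shows "good (insert (reply m) (insert m D))" (is "good ?D'")
proof -
  obtain p q where pq: "m = (p, q)" by fastforce
  have closed: "mirror_closed D" and zD: "(z, \<sigma> z) \<in> D"
    using D unfolding good_def by auto
  have closed': "mirror_closed ?D'" by (rule mirror_closed_insert2[OF closed])
  have no_win': False
    if "legal_move B ?D' n" "A \<subseteq> insert n ?D'" "reply m \<notin> A" "c \<in> cells B"
       "A = cycle_arcs c \<or> A = (cycle_arcs c)\<inverse>" for n A c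
  proof -
    have "legal_move B (insert m D) n"
      by (rule legal_move_antimono[OF _ that(1)]) blast
    moreover have "A \<subseteq> insert n (insert m D)" using that(2,3) by blast
    ultimately show False
      using no_win that(4,5) unfolding cell_completed_def directed_cell_def by blast
  qed
  have "\<not> cell_completed B (insert n ?D')" if n: "legal_move B ?D' n" for n
  proof
    assume "cell_completed B (insert n ?D')"
    then obtain c A where c: "c \<in> cells B" and A: "A = cycle_arcs c \<or> A = (cycle_arcs c)\<inverse>"
      and sub: "A \<subseteq> insert n ?D'"
      unfolding cell_completed_def directed_cell_def by blast
    have inA: "reply m \<in> A" using no_win'[OF n sub _ c A] by blast
    have "m \<notin> A"
    proof
      assume "m \<in> A"
      then have "{p, q} = {z, \<sigma> z}"
        \<comment> \<open>The instance with \<open>q\<close> and \<open>p\<close> exchanged treats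
          an \<open>A\<close> that runs against the listed order of \<open>c\<close>.\<close>
        using A inA cells_nowhere_involutive[OF c, of p q] cells_nowhere_involutive[OF c, of q p]
        by (auto simp: pq insert_commute)
      then show False using legal_move_not_axis(1)[OF zD] m pq by blast
    qed
    then have "reply m \<notin> reply ` A" by (metis imageE reply_reply)
    moreover have "reply ` A \<subseteq> insert (reply n) ?D'"
      using image_mono[OF sub, of reply] reply_image_eq[OF closed'] by auto
    moreover obtain c' where "c' \<in> cells B"
      "reply ` A = cycle_arcs c' \<or> reply ` A = (cycle_arcs c')\<inverse>"
      using directed_cell_reply_image[OF c A] .
    ultimately show False
      using no_win'[OF legal_move_reply[OF closed' n]] by blast
  qed
  then show ?thesis using closed' zD unfolding good_def by blast
qed

text \<open>Both ends of the axis have a second edge, \<open>z\<close> by assumption and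
  \<open>\<sigma> z\<close> by symmetry.\<close>

lemma legal_axis: "legal_move B {} (z, \<sigma> z)"
proof -
  obtain u where u: "{z, u} \<in> edges B" "u \<noteq> \<sigma> z" using axis_not_pendant by blast
  then have u': "{\<sigma> z, \<sigma> u} \<in> edges B" "\<sigma> u \<noteq> z" using edges_mirror by auto
  have "\<not> sink B {(z, \<sigma> z)} (\<sigma> z)" using u' unfolding sink_def
    by (auto simp: insert_commute)
  then have sk: "sink B {(z, \<sigma> z)} v \<Longrightarrow> sink B {} v" for v
    unfolding sink_def by auto
  have "\<not> source B {(z, \<sigma> z)} z" using u unfolding source_def by auto
  then have sr: "source B {(z, \<sigma> z)} v \<Longrightarrow> source B {} v" for v
    unfolding source_def by auto
  show ?thesis using axis sk sr unfolding legal_move_def by auto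
qed

lemma good_axis: "good {(z, \<sigma> z)}"
proof -
  have "\<not> cell_completed B {n, (z, \<sigma> z)}" for n
  proof
    assume "cell_completed B {n, (z, \<sigma> z)}"
    then obtain c where c: "c \<in> cells B"
      and "cycle_arcs c \<subseteq> {n, (z, \<sigma> z)} \<or> (cycle_arcs c)\<inverse> \<subseteq> {n, (z, \<sigma> z)}"
      unfolding cell_completed_def directed_cell_def by blast
    then have "card (cycle_arcs c) \<le> card {n, (z, \<sigma> z)}"
      by (metis card_inverse card_mono finite.emptyI finite.insertI)
    also have "\<dots> \<le> 2" by (simp add: card_insert_if)
    finally show False using cells_card[OF c] by simp
  qed
  then show ?thesis unfolding good_def mirror_closed_def by simp
qed

section \<open>The strategy and its invariant\<close>

definition mirror_strategy :: "'v strategy" where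
  "mirror_strategy ms =
     (if ms = [] then (z, \<sigma> z)
      else if \<exists>n. legal_move B (set ms) n \<and> cell_completed B (insert n (set ms))
      then SOME n. legal_move B (set ms) n \<and> cell_completed B (insert n (set ms))
      else reply (last ms))"

text \<open>The counterpart of \<open>good\<close> when Player 1 is to move: \<open>D\<close> is the
  position that Player 2 faced before playing \<open>last ms\<close>.\<close>

definition answerable :: "'v arc list \<Rightarrow> bool" where
  "answerable ms \<longleftrightarrow> ms = [] \<or>
     (\<exists>D. good D \<and> legal_move B D (last ms) \<and> set ms = insert (last ms) D)"

text \<open>When the search for an immediate win fails, this failure is exactly the premise
  \<open>no_win\<close> of \<open>good_reply\<close>.\<close>

lemma mirror_strategy_answerable:
  assumes "answerable ms"
  shows "legal_move B (set ms) (mirror_strategy ms)"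
    and "good (insert (mirror_strategy ms) (set ms)) \<or>
      cell_completed B (insert (mirror_strategy ms) (set ms))"
proof -
  let ?W = "\<lambda>n. legal_move B (set ms) n \<and> cell_completed B (insert n (set ms))"
  consider "ms = []" | "ms \<noteq> []" "\<exists>n. ?W n" | "ms \<noteq> []" "\<nexists>n. ?W n" by blast
  then have "legal_move B (set ms) (mirror_strategy ms) \<and>
    (good (insert (mirror_strategy ms) (set ms)) \<or>
      cell_completed B (insert (mirror_strategy ms) (set ms)))"
  proof cases
    case 1
    then show ?thesis using legal_axis good_axis by (simp add: mirror_strategy_def)
  next
    case 2
    then have "mirror_strategy ms = (SOME n. ?W n)" by (simp add: mirror_strategy_def)
    then show ?thesis using someI_ex[OF 2(2)] by simp
  next
    case 3
    then obtain D where D: "good D" "legal_move B D (last ms)" "set ms = insert (last ms) D"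
      using assms unfolding answerable_def by blast
    have "mirror_strategy ms = reply (last ms)"
      unfolding mirror_strategy_def using 3 by (simp only: if_False)
    then show ?thesis
      using legal_reply[OF D(1,2)] good_reply[OF D(1,2)] 3(2) D(3) by metis
  qed
  then show "legal_move B (set ms) (mirror_strategy ms)"
    and "good (insert (mirror_strategy ms) (set ms)) \<or>
      cell_completed B (insert (mirror_strategy ms) (set ms))" by auto
qed

lemma no_cell_at_start: "\<not> cell_completed B {}"
proof
  assume "cell_completed B {}"
  then have "cell_completed B {(z, \<sigma> z)}"
    unfolding cell_completed_def directed_cell_def by blast
  then obtain c where c: "c \<in> cells B"
    and "cycle_arcs c \<subseteq> {(z, \<sigma> z)} \<or> (cycle_arcs c)\<inverse> \<subseteq> {(z, \<sigma> z)}"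
    unfolding cell_completed_def directed_cell_def by blast
  then have "card (cycle_arcs c) \<le> card {(z, \<sigma> z)}"
    by (metis card_inverse card_mono finite.emptyI finite.insertI)
  then show False using cells_card[OF c] by simp
qed

text \<open>Player 2 has just moved from a \<open>good\<close> position, so no cell is complete, and
  the strategy itself exhibits a legal move.\<close>

lemma answerable_not_finished:
  assumes "answerable ms"
  shows "\<not> finished B ms"
proof -
  have "\<not> cell_completed B (set ms)"
    using assms no_cell_at_start unfolding answerable_def good_def
    by (metis empty_set)
  then show ?thesis
    using mirror_strategy_answerable(1)[OF assms] unfolding finished_def by blast
qed

lemma play_invariant:
  assumes "play B ms" "follows Player1 mirror_strategy ms"
  shows "if even (length ms) then answerable ms
    else good (set ms) \<or> cell_completed B (set ms)"
  using assms
proof (induction rule: play.induct)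
  case start
  then show ?case by (simp add: answerable_def)
next
  case (step ms m)
  note IH = step.IH[OF follows_append(1)[OF step.prems]]
  show ?case
  proof (cases "even (length ms)")
    case True
    then have "m = mirror_strategy ms"
      using follows_append(2)[OF step.prems] by (simp add: mover_def)
    then show ?thesis
      using IH True mirror_strategy_answerable(2)[of ms] by simp
  next
    case False
    \<comment> \<open>The play goes on, so the alternative of a completed cell is excluded.\<close>
    then have "good (set ms)"
      using IH step.hyps(2) unfolding finished_def by auto
    then show ?thesis
      using False step.hyps(3) by (auto simp: answerable_def)
  qed
qed

text \<open>Plays of even length are never finished, so a finished one has odd length and its last
  move, at an even index, is by Player 1.\<close>

theorem Player1_wins: "has_winning_strategy B Player1"
proof -
  have "if finished B ms then wins B Player1 ms
      else mover (length ms) = Player1 \<longrightarrow> legal_move B (set ms) (mirror_strategy ms)"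
    if ms: "play B ms" "follows Player1 mirror_strategy ms" for ms
  proof (cases "even (length ms)")
    case True
    then have "answerable ms" using play_invariant[OF ms] by simp
    then show ?thesis
      using answerable_not_finished mirror_strategy_answerable(1) by auto
  next
    case False
    then show ?thesis by (auto simp: wins_def mover_def)
  qed
  then show ?thesis
    unfolding has_winning_strategy_def winning_strategy_def by blast
qed

end

section \<open>The half-turn of the grid\<close>

lemma dist_plane_point_eq_1:
  "dist (plane_point p) (plane_point q) = 1 \<longleftrightarrow>
     (fst p - fst q)\<^sup>2 + (snd p - snd q)\<^sup>2 = 1"
proof -
  have "dist (plane_point p) (plane_point q) =
      sqrt (real_of_int ((fst p - fst q)\<^sup>2 + (snd p - snd q)\<^sup>2))"
    by (simp add: plane_point_def dist_Pair_Pair dist_real_def)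
  then show ?thesis by (simp only: real_sqrt_eq_1_iff of_int_eq_1_iff)
qed

lemma doubleton_in_edges_grid:
  "{p, q} \<in> edges (grid a b) \<longleftrightarrow>
     p \<in> grid_verts a b \<and> q \<in> grid_verts a b \<and> (fst p - fst q)\<^sup>2 + (snd p - snd q)\<^sup>2 = 1"
  (is "?L \<longleftrightarrow> ?R")
proof
  show "?R \<Longrightarrow> ?L" unfolding grid_def dist_plane_point_eq_1 board.select_convs by blast
  assume ?L
  then obtain p' q' where "{p, q} = {p', q'}" "p' \<in> grid_verts a b" "q' \<in> grid_verts a b"
    "(fst p' - fst q')\<^sup>2 + (snd p' - snd q')\<^sup>2 = 1"
    unfolding grid_def dist_plane_point_eq_1 by auto
  then show ?R by (auto simp: doubleton_eq_iff power2_commute)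
qed

lemma cycle_arcs_4: "cycle_arcs [p, q, r, s] = {(p, q), (q, r), (r, s), (s, p)}"
proof -
  have "cycle_arcs [p, q, r, s] =
      (\<lambda>i. ([p, q, r, s] ! i, [p, q, r, s] ! (Suc i mod 4))) ` {..<4}"
    unfolding cycle_arcs_def by auto
  also have "{..<4::nat} = {0, 1, 2, 3}" by auto
  finally show ?thesis by simp
qed

text \<open>The rotation by 180 degrees about the centre of the grid; the first coordinate goes with
  \<open>b\<close>, the number of columns.\<close>

definition half_turn :: "nat \<Rightarrow> nat \<Rightarrow> int \<times> int \<Rightarrow> int \<times> int" where
  "half_turn a b p = (int b - 1 - fst p, int a - 1 - snd p)"

lemma square_sum_eq_1_int:
  fixes x y :: int
  assumes "x\<^sup>2 + y\<^sup>2 = 1"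
  shows "\<bar>x\<bar> + \<bar>y\<bar> = 1"
proof -
  have "x\<^sup>2 \<le> 1" "y\<^sup>2 \<le> 1" using assms zero_le_power2[of x] zero_le_power2[of y] by linarith+
  then have "\<bar>x\<bar> \<le> 1" "\<bar>y\<bar> \<le> 1" by (simp_all add: abs_square_le_1)
  then have "x \<in> {-1, 0, 1}" "y \<in> {-1, 0, 1}" by auto
  then show ?thesis using assms by auto
qed

text \<open>Exactly one coordinate of the centre is a half-integer, so the centre is the midpoint of
  an edge. That edge is the axis, and \<open>div\<close> rounds the centre down to its left or lower
  end.\<close>

lemma mirror_board_grid:
  assumes "a > 0" "b > 0" "odd a \<noteq> odd b" "{a, b} \<noteq> {1, 2}"
  shows "mirror_board (grid a b) (half_turn a b) ((int b - 1) div 2, (int a - 1) div 2)"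
    (is "mirror_board ?B ?\<sigma> ?z")
proof -
  \<comment> \<open>In both cases the axis starts at \<open>(l, k)\<close>; it ends at
    \<open>(l + 1, k)\<close> in the first and at \<open>(l, k + 1)\<close> in the second.\<close>
  have par: "(\<exists>k l. int a = 2 * k + 1 \<and> int b = 2 * l + 2) \<or>
             (\<exists>k l. int a = 2 * k + 2 \<and> int b = 2 * l + 1)"
    using assms(3) by presburger
  have large: "int a > 2 \<or> int b > 2"
    using assms by (auto simp: doubleton_eq_iff) presburger+
  show ?thesis
  proof
    show "?\<sigma> (?\<sigma> v) = v" for v by (simp add: half_turn_def)
    show "?\<sigma> v \<in> verts ?B" if "v \<in> verts ?B" for v
      using that by (auto simp: grid_def grid_verts_def half_turn_def)
    show "{?\<sigma> u, ?\<sigma> v} \<in> edges ?B" if "{u, v} \<in> edges ?B" for u v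
      using that unfolding doubleton_in_edges_grid
      by (auto simp: grid_verts_def half_turn_def power2_commute)
    show "u \<in> verts ?B" if "{u, v} \<in> edges ?B" for u v
      using that unfolding doubleton_in_edges_grid by (simp add: grid_def)
    show "?\<sigma> v \<noteq> v" if "v \<in> verts ?B" for v
    proof
      assume "?\<sigma> v = v"
      then have "int b - 1 - fst v = fst v" "int a - 1 - snd v = snd v"
        by (auto simp: half_turn_def prod_eq_iff)
      then show False using par by presburger
    qed
    show "{?z, ?\<sigma> ?z} \<in> edges ?B"
      unfolding doubleton_in_edges_grid
      using par assms(1,2) by (auto simp: grid_verts_def half_turn_def)
    show "{v, ?\<sigma> v} = {?z, ?\<sigma> ?z}" if "{v, ?\<sigma> v} \<in> edges ?B" for v
    proof -
      obtain x y where v: "v = (x, y)" by fastforce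
      \<comment> \<open>By parity one of the two terms is even, hence 0, and the other is 1.\<close>
      have "\<bar>2 * x - (int b - 1)\<bar> + \<bar>2 * y - (int a - 1)\<bar> = 1"
        using square_sum_eq_1_int that unfolding doubleton_in_edges_grid
        by (force simp: v half_turn_def algebra_simps)
      then have "v = ?z \<or> v = ?\<sigma> ?z"
        using par unfolding v half_turn_def by auto
      then show ?thesis by (auto simp: half_turn_def)
    qed
    show "\<exists>u. {?z, u} \<in> edges ?B \<and> u \<noteq> ?\<sigma> ?z"
    proof -
      \<comment> \<open>The image of \<open>?z\<close> lies to its right or above it, so a step left
        or down yields a different edge. It stays in the grid along a side longer than 2.\<close>
      have ne: "(fst ?z - 1, snd ?z) \<noteq> ?\<sigma> ?z" "(fst ?z, snd ?z - 1) \<noteq> ?\<sigma> ?z"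
        by (auto simp: half_turn_def)
      have in_edges: "{?z, (fst ?z - 1, snd ?z)} \<in> edges ?B" if "int b > 2"
        unfolding doubleton_in_edges_grid using that assms(1) by (auto simp: grid_verts_def)
      have in_edges': "{?z, (fst ?z, snd ?z - 1)} \<in> edges ?B" if "int a > 2"
        unfolding doubleton_in_edges_grid using that assms(2) by (auto simp: grid_verts_def)
      show ?thesis using ne in_edges in_edges' large by blast
    qed
  next
    fix c assume "c \<in> cells ?B"
    then obtain x y where c: "c = [(x, y), (x + 1, y), (x + 1, y + 1), (x, y + 1)]"
      and sub: "{(x, y), (x + 1, y), (x + 1, y + 1), (x, y + 1)} \<subseteq> grid_verts a b"
      unfolding grid_def by auto
    \<comment> \<open>The lower left corner of the image cell is the image of the upper right corner
      of \<open>c\<close>. The cyclic sense is preserved and the starting point moves by two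
      places.\<close>
    let ?x = "int b - 2 - x" and ?y = "int a - 2 - y"
    let ?c = "[(?x, ?y), (?x + 1, ?y), (?x + 1, ?y + 1), (?x, ?y + 1)]"
    have "{(?x, ?y), (?x + 1, ?y), (?x + 1, ?y + 1), (?x, ?y + 1)} \<subseteq> grid_verts a b"
      using sub by (auto simp: grid_verts_def)
    then have "?c \<in> cells ?B" unfolding grid_def by auto
    moreover have "cycle_arcs ?c = map_prod ?\<sigma> ?\<sigma> ` cycle_arcs c"
    proof -
      have "?\<sigma> (x, y) = (?x + 1, ?y + 1)" "?\<sigma> (x + 1, y) = (?x, ?y + 1)"
        "?\<sigma> (x + 1, y + 1) = (?x, ?y)" "?\<sigma> (x, y + 1) = (?x + 1, ?y)"
        by (simp_all add: half_turn_def)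
      then show ?thesis
        unfolding c cycle_arcs_4 image_insert image_empty map_prod_simp by (simp only:) blast
    qed
    ultimately show "\<exists>c' \<in> cells ?B. cycle_arcs c' = map_prod ?\<sigma> ?\<sigma> ` cycle_arcs c" ..
    show "card (cycle_arcs c) > 2" unfolding c cycle_arcs_4 by simp
    show "{p, q} = {?z, ?\<sigma> ?z}"
      if pq: "(p, q) \<in> cycle_arcs c" and pq': "(?\<sigma> q, ?\<sigma> p) \<in> cycle_arcs c" for p q
    proof -
      obtain p1 p2 q1 q2 where p: "p = (p1, p2)" and q: "q = (q1, q2)" by fastforce
      have ne: "p1 \<noteq> q1 \<or> p2 \<noteq> q2" using pq unfolding c cycle_arcs_4 p q by auto
      have corner: "p1 \<in> {x, x + 1}" "p2 \<in> {y, y + 1}" "q1 \<in> {x, x + 1}" "q2 \<in> {y, y + 1}"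
        using pq unfolding c cycle_arcs_4 p q by auto
      \<comment> \<open>A coordinate and its reflection now lie in the same pair of consecutive
        integers. Along the odd side their sum is even, so both are the middle value; along the even
        side it is odd, so they are the two middle values. Thus \<open>p\<close> and
        \<open>q\<close> are the ends of the axis.\<close>
      have corner': "int b - 1 - p1 \<in> {x, x + 1}" "int a - 1 - p2 \<in> {y, y + 1}"
        "int b - 1 - q1 \<in> {x, x + 1}" "int a - 1 - q2 \<in> {y, y + 1}"
        using pq' unfolding c cycle_arcs_4 p q half_turn_def by auto
      from par show ?thesis
      proof (elim disjE exE conjE)
        fix k l assume ab: "int a = 2 * k + 1" "int b = 2 * l + 2"
        then have "p2 = k" "q2 = k" using corner(2,4) corner'(2,4) by auto
        moreover have "p1 = l \<and> q1 = l + 1 \<or> p1 = l + 1 \<and> q1 = l"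
          using ab corner(1,3) corner'(1,3) ne calculation by auto
        ultimately show ?thesis by (auto simp: p q half_turn_def ab)
      next
        fix k l assume ab: "int a = 2 * k + 2" "int b = 2 * l + 1"
        then have "p1 = l" "q1 = l" using corner(1,3) corner'(1,3) by auto
        moreover have "p2 = k \<and> q2 = k + 1 \<or> p2 = k + 1 \<and> q2 = k"
          using ab corner(2,4) corner'(2,4) ne calculation by auto
        ultimately show ?thesis by (auto simp: p q half_turn_def ab)
      qed
    qed
  qed
qed

text \<open>The case excluded by \<open>nondegenerate\<close> is a single edge: directing it would
  make one end a sink, so there is no legal move and nobody wins.\<close>

theorem theorem6:
  fixes a b :: nat
  assumes "a > 0" and "b > 0"
    and "odd a \<noteq> odd b"
    and nondegenerate: "{a, b} \<noteq> {1, 2}"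
  shows "has_winning_strategy (grid a b) Player1"
  using mirror_board.Player1_wins[OF mirror_board_grid[OF assms]] .

end
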